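(* Let $k$ be a positive integer and let $D$ be a spine digraph, i.e. a digraph whose vertex set admits a partition $\{X,Y\}$ such that the subdigraph $D[X]$ induced by $X$ is traceable (has a Hamiltonian path) and $Y$ is a stable set of $D$. Then $\pi_k(D) \leq \alpha_k(D)$.
   Context: Digraphs have no loops and no parallel arcs (directed 2-cycles are allowed). Paths are directed paths; the size $|P|$ of a path $P$ is its number of vertices. A stable set of $D$ is a stable set of its underlying undirected graph; two vertices $u,v$ are adjacent if $(u,v)\in A(D)$ or $(v,u)\in A(D)$. A path partition of $D$ is a set of vertex-disjoint paths covering $V(D)$. The $k$-norm of a path partition $\mathcal{P}$ is $|\mathcal{P}|_k=\sum_{P\in\mathcal{P}}\min\{|P|,k\}$, and $\pi_k(D)$ is the minimum $k$-norm over all path partitions of $D$. A $k$-partial coloring is a set of $k$ pairwise disjoint stable sets (color classes; empty classes allowed); its weight is the sum of the sizes of its classes, and $\alpha_k(D)$ is the maximum weight of a $k$-partial coloring of $D$. *)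

theory Defs
  imports
    "HOL-Library.Disjoint_Sets"
    "Graph_Theory.Digraph_Component_Vwalk"
begin

definition adjacent :: "('a, 'b) pre_digraph \<Rightarrow> 'a \<Rightarrow> 'a \<Rightarrow> bool" where
  "adjacent D u v \<longleftrightarrow> (u, v) \<in> arcs_ends D \<or> (v, u) \<in> arcs_ends D"

definition stable_set :: "('a, 'b) pre_digraph \<Rightarrow> 'a set \<Rightarrow> bool" where
  "stable_set D S \<longleftrightarrow> S \<subseteq> verts D \<and> (\<forall>u\<in>S. \<forall>v\<in>S. \<not> adjacent D u v)"

(* Paths are given by their vertex lists; a digraph without parallel arcs loses nothing
   that way. A vpath is non-empty, so the null digraph is not traceable. *)
definition traceable :: "('a, 'b) pre_digraph \<Rightarrow> bool" where
  "traceable D \<longleftrightarrow> (\<exists>p. vpath p D \<and> set p = verts D)"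

(* Y = {} is allowed. *)
definition spine :: "('a, 'b) pre_digraph \<Rightarrow> bool" where
  "spine D \<longleftrightarrow> (\<exists>X Y. X \<union> Y = verts D \<and> X \<inter> Y = {} \<and>
     traceable (D \<restriction> X) \<and> stable_set D Y)"

definition path_partition :: "('a, 'b) pre_digraph \<Rightarrow> 'a list set \<Rightarrow> bool" where
  "path_partition D P \<longleftrightarrow> (\<forall>p\<in>P. vpath p D) \<and>
     pairwise (\<lambda>p q. set p \<inter> set q = {}) P \<and> (\<Union>p\<in>P. set p) = verts D"

definition k_norm :: "nat \<Rightarrow> 'a list set \<Rightarrow> nat" where
  "k_norm k P = (\<Sum>p\<in>P. min (length p) k)"

definition pi_k :: "nat \<Rightarrow> ('a, 'b) pre_digraph \<Rightarrow> nat" where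
  "pi_k k D = Min {k_norm k P | P. path_partition D P}"

(* The color classes are indexed by {..<k}, so that the empty class may occur repeatedly. *)
definition partial_coloring :: "nat \<Rightarrow> ('a, 'b) pre_digraph \<Rightarrow> (nat \<Rightarrow> 'a set) \<Rightarrow> bool" where
  "partial_coloring k D C \<longleftrightarrow>
     (\<forall>i<k. stable_set D (C i)) \<and> disjoint_family_on C {..<k}"

definition coloring_weight :: "nat \<Rightarrow> (nat \<Rightarrow> 'a set) \<Rightarrow> nat" where
  "coloring_weight k C = (\<Sum>i<k. card (C i))"

definition alpha_k :: "nat \<Rightarrow> ('a, 'b) pre_digraph \<Rightarrow> nat" where
  "alpha_k k D = Max {coloring_weight k C | C. partial_coloring k D C}"

(* In a finite digraph the minimum and the maximum range over finite non-empty sets. *)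

lemma finite_k_norms:
  assumes "digraph D"
  shows "finite {k_norm k P | P. path_partition D P}"
proof -
  interpret digraph D by fact
  let ?L = "{p. set p \<subseteq> verts D \<and> distinct p}"
  have "finite ?L"
    using finite_subset_distinct[OF finite_verts] by simp
  moreover have "{P. path_partition D P} \<subseteq> Pow ?L"
    by (auto simp: path_partition_def vpath_def vwalk_def)
  ultimately have "finite {P. path_partition D P}"
    using finite_subset by blast
  then show ?thesis by simp
qed

lemma k_norms_nonempty: "{k_norm k P | P. path_partition D P} \<noteq> {}"
proof -
  have "path_partition D ((\<lambda>v. [v]) ` verts D)"
    by (auto simp: path_partition_def vpath_def vwalk_def pairwise_def)
  then show ?thesis by blast
qed

lemma finite_coloring_weights:
  assumes "digraph D"
  shows "finite {coloring_weight k C | C. partial_coloring k D C}"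
proof -
  interpret digraph D by fact
  have "coloring_weight k C \<le> card (verts D)" if C: "partial_coloring k D C" for C
  proof -
    have sub: "C i \<subseteq> verts D" if "i < k" for i
      using C that by (auto simp: partial_coloring_def stable_set_def)
    then have fin: "\<forall>i\<in>{..<k}. finite (C i)"
      using finite_verts finite_subset by blast
    have "coloring_weight k C = card (\<Union>i<k. C i)"
      unfolding coloring_weight_def
      using C fin by (intro card_UN_disjoint[symmetric])
        (auto simp: partial_coloring_def disjoint_family_on_def)
    also have "\<dots> \<le> card (verts D)"
      using sub by (intro card_mono) auto
    finally show ?thesis .
  qed
  then have "{coloring_weight k C | C. partial_coloring k D C} \<subseteq> {..card (verts D)}"
    by auto
  then show ?thesis
    using finite_subset by blast
qed

lemma coloring_weights_nonempty: "{coloring_weight k C | C. partial_coloring k D C} \<noteq> {}"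
proof -
  have "partial_coloring k D (\<lambda>_. {})"
    by (auto simp: partial_coloring_def stable_set_def disjoint_family_on_def)
  then show ?thesis by blast
qed

end

theory Submission
  imports Defs
begin

text \<open>
  Let \<open>x\<^sub>1, \<dots>, x\<^sub>l\<close> be a Hamiltonian path of \<open>D[X]\<close>. Keeping this path whole gives \<open>\<pi>\<^sub>k \<le> k + |Y|\<close>, and the
  classes \<open>Y\<close> and \<open>k - 1\<close> singletons give \<open>\<alpha>\<^sub>k \<ge> k - 1 + |Y|\<close>, so only one unit is missing. It is
  gained at once if some \<open>y \<in> Y\<close> can be inserted into the path, or if some \<open>k\<close>-subset \<open>S\<close> of \<open>X\<close> has no
  common neighbour in \<open>Y\<close>: then the singletons of \<open>S\<close> extend to \<open>k\<close> stable classes covering \<open>S \<union> Y\<close>.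

  Otherwise choose \<open>e\<^sub>1 < e\<^sub>2 < \<dots> < e\<^sub>k\<close> greedily: \<open>e\<^sub>t\<^sub>+\<^sub>1\<close> is the least index for which some \<open>z\<^sub>t \<in> Y\<close> has arcs
  from all of \<open>x\<^bsub>e\<^sub>1\<^esub>, \<dots>, x\<^bsub>e\<^sub>t\<^esub>\<close> and an arc to the successor of \<open>x\<^bsub>e\<^sub>t\<^sub>+\<^sub>1\<^esub>\<close>. A common neighbour of the chosen
  vertices and \<open>x\<^sub>l\<close> shows that such an index exists, and minimality forces every common neighbour of
  the chosen vertices to be an out-neighbour of each of them. Cutting the path after every \<open>x\<^bsub>e\<^sub>t\<^esub>\<close>
  and joining the segments alternately through \<open>z\<^sub>0, \<dots>, z\<^sub>k\<close> gives two paths that cover \<open>X\<close> and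
  \<open>k + 1\<close> vertices of \<open>Y\<close>, hence \<open>\<pi>\<^sub>k \<le> 2k + |Y| - (k + 1)\<close>.
\<close>

section \<open>General bounds on \<open>pi_k\<close> and \<open>alpha_k\<close>, and joining of
  paths\<close>

lemma pi_k_le:
  assumes "digraph D" "path_partition D P"
  shows "pi_k k D \<le> k_norm k P"
  unfolding pi_k_def using assms by (intro Min_le finite_k_norms) auto

lemma alpha_k_ge_proper:
  assumes "digraph D" "V \<subseteq> verts D"
    and lt: "\<And>v. v \<in> V \<Longrightarrow> c v < k"
    and proper: "\<And>u v. u \<in> V \<Longrightarrow> v \<in> V \<Longrightarrow> adjacent D u v \<Longrightarrow> c u \<noteq> c v"
  shows "card V \<le> alpha_k k D"
proof -
  interpret digraph D by fact
  let ?C = "\<lambda>i. {v \<in> V. c v = i}"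
  have "finite V" using assms(2) finite_verts finite_subset by blast
  have "partial_coloring k D ?C"
    using assms(2) proper
    by (fastforce simp: partial_coloring_def stable_set_def disjoint_family_on_def)
  then have "coloring_weight k ?C \<le> alpha_k k D"
    unfolding alpha_k_def
    by (intro Max_ge finite_coloring_weights[OF assms(1)]) auto
  moreover have "coloring_weight k ?C = card (\<Union>i<k. ?C i)"
    unfolding coloring_weight_def using \<open>finite V\<close>
    by (intro card_UN_disjoint[symmetric]) auto
  moreover have "(\<Union>i<k. ?C i) = V" using lt by auto
  ultimately show ?thesis by simp
qed

text \<open>Either list may be empty, although \<open>vpath\<close> excludes the empty list: the
  alternating paths start out empty, and so may pieces cut from \<open>xs\<close>.\<close>

lemma vpath_append:
  assumes "p \<noteq> [] \<Longrightarrow> vpath p D" "q \<noteq> [] \<Longrightarrow> vpath q D"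
    and "p @ q \<noteq> []" "set p \<inter> set q = {}"
    and "p \<noteq> [] \<Longrightarrow> q \<noteq> [] \<Longrightarrow> last p \<rightarrow>\<^bsub>D\<^esub> hd q"
  shows "vpath (p @ q) D"
  using assms by (cases "p = []"; cases "q = []")
    (auto simp: vpath_def vwalk_def vwalk_arcs_append)

lemma vpath_take: "vpath p D \<Longrightarrow> take n p \<noteq> [] \<Longrightarrow> vpath (take n p) D"
  by (metis append_take_drop_id distinct_take vpath_def vwalkI_append_l)

lemma vpath_drop: "vpath p D \<Longrightarrow> drop n p \<noteq> [] \<Longrightarrow> vpath (drop n p) D"
  by (metis append_take_drop_id distinct_drop vpath_def vwalkI_append_r)

lemma vpath_singleton: "vpath [v] D \<longleftrightarrow> v \<in> verts D"
  by (auto simp: vpath_def vwalk_def)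

section \<open>Partitions and colourings of a spine digraph\<close>

locale spine_digraph = digraph D for D :: "('a, 'b) pre_digraph" +
  fixes xs :: "'a list" and Y :: "'a set"
  assumes path: "vpath xs D"
    and verts: "set xs \<union> Y = verts D"
    and disjoint: "set xs \<inter> Y = {}"
    and stable: "stable_set D Y"
begin

lemma finite_Y: "finite Y"
  using finite_verts verts by (metis finite_Un)

lemma distinct_xs: "distinct xs"
  using path by auto

lemma xs_nonempty: "xs \<noteq> []"
  using path by (auto simp: vpath_def vwalk_def)

text \<open>Each path of \<open>Q\<close> is charged \<open>k\<close>; the vertices of
  \<open>Y - Z\<close> become one-vertex paths, charged 1 each.\<close>

lemma pi_k_le_paths:
  assumes "finite Q" "\<And>p. p \<in> Q \<Longrightarrow> vpath p D"
    and "pairwise (\<lambda>p q. set p \<inter> set q = {}) Q"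
    and "(\<Union>p\<in>Q. set p) = set xs \<union> Z" "Z \<subseteq> Y"
  shows "pi_k k D \<le> k * card Q + card (Y - Z)"
proof -
  let ?S = "(\<lambda>y. [y]) ` (Y - Z)"
  have Q_Y: "set p \<inter> (Y - Z) = {}" if "p \<in> Q" for p
    using assms(4) disjoint that by auto
  have "path_partition D (Q \<union> ?S)"
    unfolding path_partition_def
  proof (intro conjI)
    show "\<forall>p\<in>Q \<union> ?S. vpath p D"
      using assms(2) verts by (auto simp: vpath_singleton)
    have "pairwise (\<lambda>p q. set p \<inter> set q = {}) ?S" by (auto simp: pairwise_def)
    moreover have "set p \<inter> set q = {}" if "p \<in> Q" "q \<in> ?S" for p q
      using Q_Y[OF that(1)] that(2) by auto
    ultimately show "pairwise (\<lambda>p q. set p \<inter> set q = {}) (Q \<union> ?S)"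
      using assms(3) unfolding pairwise_def by (metis Int_commute Un_iff)
    have "(\<Union>p\<in>?S. set p) = Y - Z" by auto
    then show "(\<Union>p\<in>Q \<union> ?S. set p) = verts D"
      using assms(4,5) verts by auto
  qed
  then have "pi_k k D \<le> k_norm k (Q \<union> ?S)"
    by (rule pi_k_le[OF digraph_axioms])
  also have "\<dots> \<le> (\<Sum>p\<in>Q. min (length p) k) + (\<Sum>p\<in>?S. min (length p) k)"
    unfolding k_norm_def using assms(1) finite_Y by (simp add: sum_Un_nat)
  also have "\<dots> \<le> k * card Q + card (Y - Z)"
  proof (rule add_mono)
    show "(\<Sum>p\<in>Q. min (length p) k) \<le> k * card Q"
      using sum_bounded_above[of Q "\<lambda>p. min (length p) k" k] by (simp add: mult.commute)
    have "(\<Sum>p\<in>?S. min (length p) k) \<le> (\<Sum>p\<in>?S. 1)"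
      by (rule sum_mono) auto
    also have "\<dots> \<le> card (Y - Z)"
      using finite_Y by (simp add: card_image_le)
    finally show "(\<Sum>p\<in>?S. min (length p) k) \<le> card (Y - Z)" .
  qed
  finally show ?thesis .
qed

text \<open>\<open>Y\<close> is one class, of colour \<open>card S\<close>; the vertices of
  \<open>S\<close> get distinct colours below it.\<close>

lemma alpha_k_ge_extend:
  assumes "S \<subseteq> set xs" "card S < k"
  shows "card S + card Y \<le> alpha_k k D"
proof -
  have "finite S" using assms(1) finite_subset by blast
  then obtain f where f: "bij_betw f S {..<card S}"
    using bij_betw_iff_card[of S "{..<card S}"] by auto
  then have lt: "f v < card S" if "v \<in> S" for v
    using that by (auto simp: bij_betw_def)
  have "card (S \<union> Y) \<le> alpha_k k D"
  proof (rule alpha_k_ge_proper[OF digraph_axioms])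
    show "S \<union> Y \<subseteq> verts D" using assms verts by auto
    show "(if v \<in> S then f v else card S) < k" if "v \<in> S \<union> Y" for v
      using lt[of v] assms(2) by auto
    show "(if u \<in> S then f u else card S) \<noteq> (if v \<in> S then f v else card S)"
      if "u \<in> S \<union> Y" "v \<in> S \<union> Y" "adjacent D u v" for u v
    proof -
      have "u \<noteq> v" using that(3) adj_not_same by (auto simp: adjacent_def)
      then have "f u \<noteq> f v" if "u \<in> S" "v \<in> S"
        using f that by (auto simp: bij_betw_def inj_on_def)
      moreover have "u \<in> S \<or> v \<in> S"
        using that stable by (auto simp: stable_set_def)
      ultimately show ?thesis using lt[of u] lt[of v] by auto
    qed
  qed
  moreover have "S \<inter> Y = {}" using assms(1) disjoint by auto
  ultimately show ?thesis
    using \<open>finite S\<close> finite_Y by (simp add: card_Un_disjoint)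
qed

text \<open>Each vertex of \<open>Y\<close> joins the class of a non-adjacent vertex of
  \<open>S\<close>. Of two adjacent vertices at least one lies in \<open>S\<close> and represents
  its own class, so their classes differ.\<close>

lemma alpha_k_ge_no_common_neighbour:
  assumes "S \<subseteq> set xs" "\<And>y. y \<in> Y \<Longrightarrow> \<exists>u\<in>S. \<not> adjacent D u y"
  shows "card S + card Y \<le> alpha_k (card S) D"
proof -
  have "finite S" using assms(1) finite_subset by blast
  then obtain f where f: "bij_betw f S {..<card S}"
    using bij_betw_iff_card[of S "{..<card S}"] by auto
  obtain g where g: "\<And>y. y \<in> Y \<Longrightarrow> g y \<in> S \<and> \<not> adjacent D (g y) y"
    using assms(2) by metis
  let ?g = "\<lambda>v. if v \<in> S then v else g v"
  have "card (S \<union> Y) \<le> alpha_k (card S) D"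
  proof (rule alpha_k_ge_proper[OF digraph_axioms])
    show "S \<union> Y \<subseteq> verts D" using assms verts by auto
    show "f (?g v) < card S" if "v \<in> S \<union> Y" for v
      using that f g by (auto simp: bij_betw_def)
    show "f (?g u) \<noteq> f (?g v)"
      if "u \<in> S \<union> Y" "v \<in> S \<union> Y" "adjacent D u v" for u v
    proof -
      have "u \<noteq> v" using that(3) adj_not_same by (auto simp: adjacent_def)
      moreover have "u \<in> S \<or> v \<in> S"
        using that stable by (auto simp: stable_set_def)
      ultimately have "?g u \<noteq> ?g v"
        using g that by (auto simp: adjacent_def)
      moreover have "?g u \<in> S" "?g v \<in> S" using that g by auto
      ultimately show ?thesis
        by (rule inj_on_contraD[OF bij_betw_imp_inj_on[OF f]])
    qed
  qed
  moreover have "S \<inter> Y = {}" using assms(1) disjoint by auto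
  ultimately show ?thesis
    using \<open>finite S\<close> finite_Y by (simp add: card_Un_disjoint)
qed

lemma pi_k_le_insert:
  assumes "y \<in> Y" "vpath (take i xs @ y # drop i xs) D"
  shows "pi_k k D \<le> k + card Y - 1"
proof -
  have "set (take i xs @ y # drop i xs) = set xs \<union> {y}"
    by (metis append_take_drop_id list.simps(15) set_append Un_insert_right Un_insert_left sup_bot.right_neutral)
  then have "pi_k k D \<le> k * card {take i xs @ y # drop i xs} + card (Y - {y})"
    using assms by (intro pi_k_le_paths) auto
  moreover have "card Y \<ge> 1"
    using assms finite_Y by (metis One_nat_def Suc_leI card_gt_0_iff empty_iff)
  ultimately show ?thesis using assms finite_Y by simp
qed

text \<open>
  The paths \<open>p\<close> and \<open>q\<close> cover the first \<open>m\<close> vertices of \<open>xs\<close> and \<open>t\<close> vertices of \<open>Y\<close>, alternating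
  between the segments into which \<open>xs\<close> is cut. The set \<open>E\<close> holds the last vertices of the segments.
\<close>
definition zigzag :: "nat \<Rightarrow> nat \<Rightarrow> 'a set \<Rightarrow> 'a set \<Rightarrow> 'a list \<Rightarrow> 'a list \<Rightarrow> bool" where
  "zigzag t m E Z p q \<longleftrightarrow>
     m < length xs \<and> E \<subseteq> set (take m xs) \<and> card E = t \<and> (0 < m \<longrightarrow> xs ! (m - 1) \<in> E) \<and>
     (\<forall>y\<in>Y. (\<forall>u\<in>E. adjacent D u y) \<longrightarrow> (\<forall>u\<in>E. u \<rightarrow>\<^bsub>D\<^esub> y)) \<and>
     Z \<subseteq> Y \<and> card Z = t \<and>
     (\<forall>z\<in>Z. \<exists>i<length xs. 0 < i \<and> xs ! (i - 1) \<in> E \<and> z \<rightarrow>\<^bsub>D\<^esub> xs ! i) \<and>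
     set p \<inter> set q = {} \<and> set p \<union> set q = set (take m xs) \<union> Z \<and>
     (p \<noteq> [] \<longrightarrow> vpath p D \<and> 0 < m \<and> last p = xs ! (m - 1)) \<and>
     (q \<noteq> [] \<longrightarrow> vpath q D \<and> last q \<rightarrow>\<^bsub>D\<^esub> xs ! m)"

end

section \<open>Greedy cutting when no vertex of \<open>Y\<close> can be inserted\<close>

locale insertion_free_spine_digraph = spine_digraph +
  assumes no_insert: "\<And>y i. y \<in> Y \<Longrightarrow> \<not> vpath (take i xs @ y # drop i xs) D"
begin

text \<open>The guards treat the ends: at \<open>i = 0\<close> only the arc out of \<open>y\<close>
  matters, at \<open>i = length xs\<close> only the arc into it.\<close>

lemma no_insert_arcs:
  assumes "y \<in> Y" "0 < i \<Longrightarrow> xs ! (i - 1) \<rightarrow>\<^bsub>D\<^esub> y" "i < length xs \<Longrightarrow> y \<rightarrow>\<^bsub>D\<^esub> xs ! i"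
    and "i \<le> length xs"
  shows False
proof -
  have tail: "vpath ([y] @ drop i xs) D"
    using assms verts disjoint path
    by (intro vpath_append) (auto simp: vpath_singleton vpath_drop hd_drop_conv_nth dest: in_set_dropD)
  have "set (take i xs) \<inter> set (drop i xs) = {}"
    using distinct_xs set_take_disj_set_drop_if_distinct by blast
  moreover have "last (take i xs) = xs ! (i - 1)" if "take i xs \<noteq> []"
    using that assms(4) by (simp add: last_conv_nth min_def)
  ultimately have "vpath (take i xs @ [y] @ drop i xs) D"
    using tail assms(1,2) disjoint path
    by (intro vpath_append[of "take i xs"]) (auto simp: vpath_take dest: in_set_takeD)
  then show False using no_insert[OF assms(1), of i] by simp
qed

text \<open>A used \<open>y\<close> has an arc to the successor on \<open>xs\<close> of some vertex
  of \<open>E\<close>; with an arc from that vertex, \<open>y\<close> could be inserted between the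
  two.\<close>

lemma zigzag_fresh:
  assumes "zigzag t m E Z p q" "y \<in> Y" "\<forall>u\<in>E. u \<rightarrow>\<^bsub>D\<^esub> y"
  shows "y \<notin> Z"
proof
  assume "y \<in> Z"
  then obtain i where "i < length xs" "xs ! (i - 1) \<in> E" "y \<rightarrow>\<^bsub>D\<^esub> xs ! i"
    using assms(1) unfolding zigzag_def by blast
  then show False using no_insert_arcs[of y i] assms by auto
qed

lemma zigzag_step:
  assumes zz: "zigzag t m E Z p q" and "t < k"
    and common: "\<And>S. S \<subseteq> set xs \<Longrightarrow> card S \<le> k \<Longrightarrow> \<exists>y\<in>Y. \<forall>u\<in>S. adjacent D u y"
  shows "\<exists>m E Z p q. zigzag (Suc t) m E Z p q"
proof -
  have m: "m < length xs" and E: "E \<subseteq> set (take m xs)" "card E = t" "0 < m \<Longrightarrow> xs ! (m - 1) \<in> E"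
    and forced: "\<And>y. y \<in> Y \<Longrightarrow> \<forall>u\<in>E. adjacent D u y \<Longrightarrow> \<forall>u\<in>E. u \<rightarrow>\<^bsub>D\<^esub> y"
    and Z: "Z \<subseteq> Y" "card Z = t"
      "\<forall>z\<in>Z. \<exists>i<length xs. 0 < i \<and> xs ! (i - 1) \<in> E \<and> z \<rightarrow>\<^bsub>D\<^esub> xs ! i"
    and pq: "set p \<inter> set q = {}" "set p \<union> set q = set (take m xs) \<union> Z"
    and p: "p \<noteq> [] \<Longrightarrow> vpath p D \<and> 0 < m \<and> last p = xs ! (m - 1)"
    and q: "q \<noteq> [] \<Longrightarrow> vpath q D \<and> last q \<rightarrow>\<^bsub>D\<^esub> xs ! m"
    using zz unfolding zigzag_def by blast+
  have E_xs: "E \<subseteq> set xs" using E(1) set_take_subset by fast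
  have fin: "finite E" "finite Z"
    using E_xs Z(1) finite_Y by (auto intro: finite_subset)
  define J where "J j \<longleftrightarrow> m \<le> j \<and> j < length xs \<and>
    (\<exists>y\<in>Y. (\<forall>u\<in>E. u \<rightarrow>\<^bsub>D\<^esub> y) \<and> y \<rightarrow>\<^bsub>D\<^esub> xs ! j)" for j
  \<comment> \<open>A common neighbour of \<open>E\<close> and \<open>last xs\<close> cannot be
    appended to \<open>xs\<close>, so its arc points to \<open>last xs\<close>.\<close>
  have "J (length xs - 1)"
  proof -
    have "insert (last xs) E \<subseteq> set xs" using E_xs xs_nonempty by auto
    moreover have "card (insert (last xs) E) \<le> k"
      using fin(1) E(2) \<open>t < k\<close> by (simp add: card_insert_if)
    ultimately obtain y where y: "y \<in> Y" "\<forall>u\<in>insert (last xs) E. adjacent D u y"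
      using common by blast
    moreover have "\<not> last xs \<rightarrow>\<^bsub>D\<^esub> y"
      using no_insert_arcs[of y "length xs"] y(1) xs_nonempty by (auto simp: last_conv_nth)
    ultimately show ?thesis
      using forced[of y] m xs_nonempty unfolding J_def adjacent_def
      by (auto simp: last_conv_nth intro!: bexI[of _ y])
  qed
  define j where "j = (LEAST j. J j)"
  have "J j" unfolding j_def using \<open>J (length xs - 1)\<close> by (rule LeastI)
  then obtain z where j: "m \<le> j" "j < length xs"
    and z: "z \<in> Y" "\<forall>u\<in>E. u \<rightarrow>\<^bsub>D\<^esub> z" "z \<rightarrow>\<^bsub>D\<^esub> xs ! j"
    unfolding J_def by blast
  \<comment> \<open>Otherwise \<open>z\<close> could be inserted just before \<open>xs ! m\<close>;
    hence the new segment is non-empty.\<close>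
  have "j \<noteq> m" using no_insert_arcs[of z m] z E(3) m by auto
  then have "m < j" using j by simp
  define e where "e = xs ! (j - 1)"
  \<comment> \<open>Minimality of \<open>j\<close> makes \<open>e\<close> an in-neighbour of every
    common neighbour of \<open>insert e E\<close>, which preserves the forced direction of
    arcs.\<close>
  have "\<not> J (j - 1)" using \<open>m < j\<close> not_less_Least[of "j - 1" J] unfolding j_def[symmetric] by simp
  then have not_target: "\<not> y \<rightarrow>\<^bsub>D\<^esub> e" if "y \<in> Y" "\<forall>u\<in>E. u \<rightarrow>\<^bsub>D\<^esub> y" for y
    using that \<open>m < j\<close> j unfolding J_def e_def by auto
  have z_fresh: "z \<notin> Z" by (rule zigzag_fresh[OF zz z(1,2)])
  define s where "s = drop m (take j xs)"
  have take_j: "take j xs = take m xs @ s"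
    unfolding s_def using \<open>m < j\<close> by (metis append_take_drop_id less_imp_le min.absorb1 take_take)
  have s: "s \<noteq> []" "hd s = xs ! m" "last s = e"
    unfolding s_def e_def using \<open>m < j\<close> j by (auto simp: hd_drop_conv_nth last_conv_nth)
  have dist: "distinct (take m xs @ s)"
    using distinct_xs by (metis distinct_take take_j)
  have s_xs: "set s \<subseteq> set xs" unfolding s_def by (meson set_drop_subset set_take_subset subset_trans)
  have e_s: "e \<in> set s" using s by (metis last_in_set)
  have vs: "vpath s D" unfolding s_def
    using path s(1) by (intro vpath_drop vpath_take) (auto simp: s_def)
  have disj_s: "(set p \<union> set q) \<inter> set s = {}"
    using pq(2) dist s_xs disjoint Z(1) by auto
  have z_pq: "z \<notin> set p \<union> set q \<union> set s"
    using pq(2) z(1) z_fresh s_xs disjoint by (auto dest: in_set_takeD)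
  \<comment> \<open>The roles swap: \<open>q\<close> can enter the segment at \<open>xs ! m\<close>,
    while \<open>p\<close> is empty or ends in \<open>E\<close> and so continues to
    \<open>z\<close>, from which \<open>xs ! j\<close> is reachable.\<close>
  have "zigzag (Suc t) j (insert e E) (insert z Z) (q @ s) (p @ [z])"
    unfolding zigzag_def
  proof (intro conjI)
    show "j < length xs" by (fact j(2))
    show "insert e E \<subseteq> set (take j xs)" using E(1) e_s take_j by auto
    have "e \<notin> E" using E(1) dist e_s by auto
    then show "card (insert e E) = Suc t" using fin E(2) by simp
    show "0 < j \<longrightarrow> xs ! (j - 1) \<in> insert e E" by (simp add: e_def)
    show "\<forall>y\<in>Y. (\<forall>u\<in>insert e E. adjacent D u y) \<longrightarrow> (\<forall>u\<in>insert e E. u \<rightarrow>\<^bsub>D\<^esub> y)"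
      using forced not_target by (auto simp: adjacent_def)
    show "insert z Z \<subseteq> Y" using z Z by auto
    show "card (insert z Z) = Suc t" using z_fresh fin Z(2) by simp
    show "\<forall>z'\<in>insert z Z. \<exists>i<length xs. 0 < i \<and> xs ! (i - 1) \<in> insert e E \<and> z' \<rightarrow>\<^bsub>D\<^esub> xs ! i"
      using Z(3) j \<open>m < j\<close> z(3) unfolding e_def by (metis gr_zeroI insert_iff not_less_zero)
    show "set (q @ s) \<inter> set (p @ [z]) = {}" using pq(1) disj_s z_pq by auto
    show "set (q @ s) \<union> set (p @ [z]) = set (take j xs) \<union> insert z Z"
      using pq(2) take_j by auto
    have "vpath (q @ s) D" using q vs s disj_s by (intro vpath_append) auto
    then show "q @ s \<noteq> [] \<longrightarrow> vpath (q @ s) D \<and> 0 < j \<and> last (q @ s) = xs ! (j - 1)"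
      using s \<open>m < j\<close> e_def by auto
    have "vpath (p @ [z]) D"
      using p z z_pq verts E(3) by (intro vpath_append) (auto simp: vpath_singleton)
    then show "p @ [z] \<noteq> [] \<longrightarrow> vpath (p @ [z]) D \<and> last (p @ [z]) \<rightarrow>\<^bsub>D\<^esub> xs ! j"
      using z(3) by auto
  qed
  then show ?thesis by blast
qed

lemma zigzag_exists:
  assumes "\<And>S. S \<subseteq> set xs \<Longrightarrow> card S \<le> k \<Longrightarrow> \<exists>y\<in>Y. \<forall>u\<in>S. adjacent D u y"
    and "t \<le> k"
  shows "\<exists>m E Z p q. zigzag t m E Z p q"
  using assms(2)
proof (induction t)
  case 0
  have "zigzag 0 0 {} {} [] []" using xs_nonempty by (simp add: zigzag_def)
  then show ?case by blast
next
  case (Suc t)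
  then show ?case using zigzag_step[of t _ _ _ _ _ k] assms(1) by (metis Suc_le_eq less_imp_le)
qed

lemma pi_k_le_common_neighbours:
  assumes common: "\<And>S. S \<subseteq> set xs \<Longrightarrow> card S \<le> k \<Longrightarrow> \<exists>y\<in>Y. \<forall>u\<in>S. adjacent D u y"
  shows "pi_k k D \<le> k + card Y - 1"
proof -
  obtain m E Z p q where zz: "zigzag k m E Z p q"
    using zigzag_exists[OF common, of k k] by auto
  then have m: "m < length xs" and E: "E \<subseteq> set (take m xs)" "card E = k" "0 < m \<Longrightarrow> xs ! (m - 1) \<in> E"
    and forced: "\<And>y. y \<in> Y \<Longrightarrow> \<forall>u\<in>E. adjacent D u y \<Longrightarrow> \<forall>u\<in>E. u \<rightarrow>\<^bsub>D\<^esub> y"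
    and Z: "Z \<subseteq> Y" "card Z = k"
    and pq: "set p \<inter> set q = {}" "set p \<union> set q = set (take m xs) \<union> Z"
    and p: "p \<noteq> [] \<Longrightarrow> vpath p D \<and> 0 < m \<and> last p = xs ! (m - 1)"
    and q: "q \<noteq> [] \<Longrightarrow> vpath q D \<and> last q \<rightarrow>\<^bsub>D\<^esub> xs ! m"
    unfolding zigzag_def by blast+
  \<comment> \<open>A common neighbour \<open>z\<close> of \<open>E\<close> is a fresh vertex that
    closes \<open>p\<close>, and \<open>q\<close> runs on through the rest of
    \<open>xs\<close>.\<close>
  have "E \<subseteq> set xs" using E(1) set_take_subset by fast
  then obtain z where z: "z \<in> Y" "\<forall>u\<in>E. u \<rightarrow>\<^bsub>D\<^esub> z"
    using common[of E] E(2) forced by blast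
  have z_fresh: "z \<notin> Z" by (rule zigzag_fresh[OF zz z])
  have fin: "finite Z" using Z(1) finite_Y by (rule finite_subset)
  have take_drop: "set (take m xs) \<union> set (drop m xs) = set xs" "set (take m xs) \<inter> set (drop m xs) = {}"
    using distinct_xs by (metis append_take_drop_id set_append)
      (simp add: set_take_disj_set_drop_if_distinct distinct_xs)
  have disj_drop: "(set p \<union> set q) \<inter> set (drop m xs) = {}"
    using pq(2) take_drop disjoint Z(1) by auto
  have z_pq: "z \<notin> set p \<union> set q \<union> set (drop m xs)"
    using pq(2) z(1) z_fresh take_drop disjoint by auto
  let ?Q = "{p @ [z], q @ drop m xs}"
  have "vpath (p @ [z]) D"
    using p z z_pq verts E(3) by (intro vpath_append) (auto simp: vpath_singleton)
  moreover have "vpath (q @ drop m xs) D"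
    using q m path disj_drop by (intro vpath_append) (auto simp: vpath_drop hd_drop_conv_nth)
  moreover have "set (p @ [z]) \<inter> set (q @ drop m xs) = {}"
    using pq(1) disj_drop z_pq by auto
  moreover have "(\<Union>r\<in>?Q. set r) = set xs \<union> insert z Z"
    using pq(2) take_drop by auto
  ultimately have "pi_k k D \<le> k * card ?Q + card (Y - insert z Z)"
    using z(1) Z(1) by (intro pi_k_le_paths) (auto simp: pairwise_def)
  also have "\<dots> \<le> k * 2 + card (Y - insert z Z)"
    by (simp add: card_insert_if)
  also have "card (Y - insert z Z) = card Y - Suc k"
    using z(1) Z z_fresh fin by (simp add: card_Diff_subset)
  finally have "pi_k k D \<le> k * 2 + (card Y - Suc k)" .
  \<comment> \<open>This keeps the natural subtraction \<open>card Y - Suc k\<close> from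
    truncating.\<close>
  moreover have "Suc k \<le> card Y"
    using z(1) Z z_fresh fin finite_Y card_mono[of Y "insert z Z"] by simp
  ultimately show ?thesis by simp
qed

end

section \<open>Combining the cases\<close>

theorem theorem2:
  fixes D :: "('a, 'b) pre_digraph" and k :: nat
  assumes "k > 0" and "digraph D" and "spine D"
  shows "pi_k k D \<le> alpha_k k D"
proof -
  interpret digraph D by fact
  obtain X Y xs where XY: "X \<union> Y = verts D" "X \<inter> Y = {}" "stable_set D Y"
    and xs: "vpath xs (D \<restriction> X)" "set xs = X"
    using assms(3) unfolding spine_def traceable_def by auto
  have "induced_subgraph (D \<restriction> X) D"
    using XY(1) by (intro induced_induce) auto
  then have "vpath xs D" using xs(1) vpathI_subgraph by blast
  then interpret spine_digraph D xs Y
    using XY xs by unfold_locales auto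
  have lower: "k + card Y - 1 \<le> alpha_k k D" if large: "k \<le> card X"
  proof -
    obtain S where "S \<subseteq> X" "card S = k - 1"
      using large by (meson diff_le_self le_trans obtain_subset_with_card_n)
    then show ?thesis using alpha_k_ge_extend[of S k] xs(2) assms(1) by auto
  qed
  show ?thesis
  proof (cases "card X < k")
    case True
    \<comment> \<open>One-vertex paths suffice here, since a partial colouring covers all of
      \<open>D\<close>.\<close>
    have "pi_k k D \<le> k_norm k ((\<lambda>v. [v]) ` verts D)"
      by (intro pi_k_le assms) (auto simp: path_partition_def vpath_singleton pairwise_def)
    also have "\<dots> \<le> (\<Sum>p\<in>(\<lambda>v. [v]) ` verts D. 1)"
      unfolding k_norm_def by (rule sum_mono) auto
    also have "\<dots> \<le> card (verts D)" by (simp add: card_image_le)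
    also have "\<dots> = card X + card Y"
      using XY finite_verts by (metis card_Un_disjoint finite_Un)
    also have "\<dots> \<le> alpha_k k D" using alpha_k_ge_extend[of X k] True xs(2) by simp
    finally show ?thesis .
  next
    case False
    show ?thesis
    proof (cases "\<exists>S\<subseteq>X. card S = k \<and> (\<forall>y\<in>Y. \<exists>u\<in>S. \<not> adjacent D u y)")
      case True
      then have "k + card Y \<le> alpha_k k D"
        using alpha_k_ge_no_common_neighbour xs(2) by blast
      moreover have "pi_k k D \<le> k * card {xs} + card (Y - {})"
        using path by (intro pi_k_le_paths) auto
      ultimately show ?thesis by simp
    next
      case no_coloring: False
      \<comment> \<open>The case gives common neighbours for sets of size exactly \<open>k\<close>;
        the greedy choice also uses smaller sets, which are enlarged within
        \<open>X\<close>.\<close>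
      have common: "\<exists>y\<in>Y. \<forall>u\<in>S. adjacent D u y" if S: "S \<subseteq> set xs" "card S \<le> k" for S
      proof -
        obtain T where T: "S \<subseteq> T" "T \<subseteq> X" "card T = k"
          using exists_subset_between[of S k X] S False xs(2) by auto
        with no_coloring have "\<exists>y\<in>Y. \<forall>u\<in>T. adjacent D u y" by metis
        with T(1) show ?thesis by (meson subsetD)
      qed
      have "pi_k k D \<le> k + card Y - 1"
      proof (cases "\<exists>y\<in>Y. \<exists>i. vpath (take i xs @ y # drop i xs) D")
        case True
        then show ?thesis using pi_k_le_insert by blast
      next
        case False
        then interpret insertion_free_spine_digraph D xs Y
          by unfold_locales auto
        show ?thesis using common by (rule pi_k_le_common_neighbours)
      qed
      then show ?thesis using lower False by simp
    qed
  qed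
qed

end
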